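(* Assume that the linear independence constraint qualification (LICQ) holds. Then, regardless of initial conditions, the SCvx algorithm always has limit points (limit points of the sequence $\{z^k\}$ it generates), and any limit point $\bar z$ is a stationary point of the nonconvex penalty problem $\min_{z\in\mathbb{R}^{n_z}}J(z)$, i.e. $0\in\partial J(\bar z)$. Furthermore, if $\bar z$ is feasible for the original nonconvex problem (P), then $\bar z$ is a KKT point of (P).
   Context: **Original problem (P).** Minimize $g_0(z)$ over $z\in\mathbb{R}^{n_z}$ subject to $g_i(z)=0$ for $i\in\mathcal I_{eq}=\{1,\dots,e\}$, $g_i(z)\le 0$ for $i\in\mathcal I_{ineq}=\{e+1,\dots,p\}$ (nonconvex constraints), and $h_j(z)\le 0$ for $j\in\mathcal J_{ineq}=\{1,\dots,q\}$ (convex constraints). All $g_0,g_i,h_j:\mathbb{R}^{n_z}\to\mathbb{R}$ are continuously differentiable and the $h_j$ are convex. The problem is a discretized optimal control problem: $z$ stacks the states and controls over all time steps. **Penalty function.** For fixed weights $\lambda_i\ge 0$, $\tau_j\ge0$, $$J(z)=g_0(z)+\sum_{i\in\mathcal I_{eq}}\lambda_i|g_i(z)|+\sum_{i\in\mathcal I_{ineq}}\lambda_i\max(0,g_i(z))+\sum_{j\in\mathcal J_{ineq}}\tau_j\max(0,h_j(z)).$$ **Generalized differential and stationarity.** $$\partial J(\bar z)=\{\nu\in\mathbb{R}^{n_z}: J(\bar z+y)\ge J(\bar z)+\nu^Ty\ \ \forall y\in\mathbb{R}^{n_z}\}.$$ A point $\bar z$ is a stationary point of the penalty problem if $0\in\partial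 J(\bar z)$. **Linearized penalty function** at $z^k$: $$L^k(d)=g_0(z^k)+\nabla g_0(z^k)^Td+\sum_{i\in\mathcal I_{eq}}\lambda_i|g_i(z^k)+\nabla g_i(z^k)^Td|+\sum_{i\in\mathcal I_{ineq}}\lambda_i\max(0,g_i(z^k)+\nabla g_i(z^k)^Td)+\sum_{j\in\mathcal J_{ineq}}\tau_j\max(0,h_j(z^k)+\nabla h_j(z^k)^Td).$$ **SCvx algorithm.** Inputs: an initial point $z^1\in Z$, a radius $r^1>0$, penalty weights, a tolerance $\epsilon_{tol}$, and parameters $0<\rho_0<\rho_1<\rho_2<1$, $r_l>0$, $\alpha>1$, $\beta>1$. While not converged, i.e. while $\Delta J^k>\epsilon_{tol}$, do the following. Step 1: at $(z^k,r^k)$ compute an optimal solution $d$ of: minimize $L^k(d)$ subject to $\|d\|\le r^k$. Step 2: compute the actual change $\Delta J^k=J(z^k)-J(z^k+d)$ and the predicted change $\Delta L^k=J(z^k)-L^k(d)$. If $\Delta J^k=0$, stop and return $z^k$; otherwise compute $\rho^k=\Delta J^k/\Delta L^k$. Step 3: if $\rho^k<\rho_0$, reject the step, replace $r^k$ by $r^k/\alpha$ and go back to Step 1. Otherwise accept the step, $z^{k+1}=z^k+d$, and set $r^{k+1}=r^k/\alpha$ if $\rho^k<\rho_1$, $r^{k+1}=r^k$ if $\rho_1\le\rho^k<\rho_2$, $r^{k+1}=\beta r^k$ if $\rho^k\ge\rho_2$. Then replace $r^{k+1}$ by $\max\{r^{k+1},r_l\}$, increase $k$ by one, and go back to Step 1.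 When the loop ends, return $z^{k+1}$. **Standing assumption.** The region $Z\subset\mathbb{R}^{n_z}$ in which the iterates lie (the product of the convex compact state and control sets) is convex and compact. **LICQ.** With $I_{ac}(\bar z)=\{i\in\mathcal I_{ineq}:g_i(\bar z)=0\}$ and $J_{ac}(\bar z)=\{j\in\mathcal J_{ineq}:h_j(\bar z)=0\}$, LICQ is satisfied at $\bar z$ if the vectors $\nabla g_i(\bar z)$ ($i\in\mathcal I_{eq}\cup I_{ac}(\bar z)$), $\nabla h_j(\bar z)$ ($j\in J_{ac}(\bar z)$) are linearly independent. Here it is assumed at the limit points $\bar z$. **KKT point of (P).** A feasible point $\bar z$ of (P) for which there exist $\bar\mu_i\in\mathbb{R}$ ($i\in\mathcal I_{eq}$), $\bar\mu_i\ge0$ ($i\in\mathcal I_{ineq}$), $\bar\sigma_j\ge0$ ($j\in\mathcal J_{ineq}$) with $$\nabla g_0(\bar z)+\sum_{i\in\mathcal I_{eq}}\bar\mu_i\nabla g_i(\bar z)+\sum_{i\in I_{ac}(\bar z)}\bar\mu_i\nabla g_i(\bar z)+\sum_{j\in J_{ac}(\bar z)}\bar\sigma_j\nabla h_j(\bar z)=0.$$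
   Formalization: The inequality defining ∂J is required only up to o(|y|) (same set for convex J), since the global version makes the claim false (a limit point need not be a global minimizer); the sequence {z^k} is that of a nonterminating run. *)

theory Defs
  imports "HOL-Analysis.Analysis"
begin

definition gradient :: "('v::real_inner \<Rightarrow> real) \<Rightarrow> 'v \<Rightarrow> 'v" where
  "gradient f z = (THE D. GDERIV f z :> D)"

definition continuously_differentiable :: "('v::real_inner \<Rightarrow> real) \<Rightarrow> bool" where
  "continuously_differentiable f \<longleftrightarrow>
     (\<forall>z. GDERIV f z :> gradient f z) \<and> continuous_on UNIV (gradient f)"

text \<open>
  The data of the problem are \<open>e\<close>, \<open>p\<close>, \<open>q\<close>, \<open>g\<close>, \<open>h\<close>: the objective is \<open>g 0\<close>, the equality
  constraints are \<open>g 1, \<dots>, g e\<close>, the nonconvex inequality constraints \<open>g (e+1), \<dots>, g p\<close> and the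
  convex inequality constraints \<open>h 1, \<dots>, h q\<close>.
\<close>

definition penalty ::
  "nat \<Rightarrow> nat \<Rightarrow> nat \<Rightarrow> (nat \<Rightarrow> 'v \<Rightarrow> real) \<Rightarrow> (nat \<Rightarrow> 'v \<Rightarrow> real) \<Rightarrow>
   (nat \<Rightarrow> real) \<Rightarrow> (nat \<Rightarrow> real) \<Rightarrow> 'v::real_inner \<Rightarrow> real" where
  "penalty e p q g h lam tau z =
     g 0 z
     + (\<Sum>i\<in>{1..e}. lam i * \<bar>g i z\<bar>)
     + (\<Sum>i\<in>{e+1..p}. lam i * max 0 (g i z))
     + (\<Sum>j\<in>{1..q}. tau j * max 0 (h j z))"

definition linearization :: "('v::real_inner \<Rightarrow> real) \<Rightarrow> 'v \<Rightarrow> 'v \<Rightarrow> real" where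
  "linearization f z d = f z + gradient f z \<bullet> d"

definition linearized_penalty ::
  "nat \<Rightarrow> nat \<Rightarrow> nat \<Rightarrow> (nat \<Rightarrow> 'v \<Rightarrow> real) \<Rightarrow> (nat \<Rightarrow> 'v \<Rightarrow> real) \<Rightarrow>
   (nat \<Rightarrow> real) \<Rightarrow> (nat \<Rightarrow> real) \<Rightarrow> 'v::real_inner \<Rightarrow> 'v \<Rightarrow> real" where
  "linearized_penalty e p q g h lam tau z d =
     linearization (g 0) z d
     + (\<Sum>i\<in>{1..e}. lam i * \<bar>linearization (g i) z d\<bar>)
     + (\<Sum>i\<in>{e+1..p}. lam i * max 0 (linearization (g i) z d))
     + (\<Sum>j\<in>{1..q}. tau j * max 0 (linearization (h j) z d))"

text \<open>
  The subgradient inequality \<open>J (z + y) \<ge> J z + \<nu> \<bullet> y\<close> is required up to an error \<open>o(norm y)\<close>.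
  Without the error term, \<open>0\<close> would belong to the generalized differential exactly at the global
  minimizers of \<open>J\<close>, whereas for nonconvex \<open>J\<close> the algorithm can converge to a local minimizer.
  For convex \<open>J\<close> the error term makes no difference, see
  \<open>generalized_differential_convex\<close> below.
\<close>

definition generalized_differential :: "('v::real_inner \<Rightarrow> real) \<Rightarrow> 'v \<Rightarrow> 'v set" where
  "generalized_differential J z =
     {\<nu>. \<forall>\<epsilon>>0. \<exists>\<delta>>0. \<forall>y. norm y < \<delta> \<longrightarrow> J (z + y) \<ge> J z + \<nu> \<bullet> y - \<epsilon> * norm y}"

definition stationary_point :: "('v::real_inner \<Rightarrow> real) \<Rightarrow> 'v \<Rightarrow> bool" where
  "stationary_point J z \<longleftrightarrow> 0 \<in> generalized_differential J z"

lemma generalized_differential_convex: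
  fixes J :: "'v::real_inner \<Rightarrow> real"
  assumes "convex_on UNIV J"
  shows "generalized_differential J z = {\<nu>. \<forall>y. J (z + y) \<ge> J z + \<nu> \<bullet> y}"
proof (intro set_eqI iffI)
  fix \<nu> assume "\<nu> \<in> {\<nu>. \<forall>y. J (z + y) \<ge> J z + \<nu> \<bullet> y}"
  then have "J z + \<nu> \<bullet> y - \<epsilon> * norm y \<le> J (z + y)" if "\<epsilon> > 0" for \<epsilon> y
    using that by (smt (verit) mem_Collect_eq mult_nonneg_nonneg norm_ge_zero)
  then show "\<nu> \<in> generalized_differential J z"
    unfolding generalized_differential_def using zero_less_one by blast
next
  fix \<nu> assume \<nu>: "\<nu> \<in> generalized_differential J z"
  have "J z + \<nu> \<bullet> y \<le> J (z + y)" for y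
  proof -
    have "J z + \<nu> \<bullet> y \<le> J (z + y) + \<epsilon> * norm y" if "\<epsilon> > 0" for \<epsilon>
    proof -
      obtain \<delta> where \<delta>: "\<delta> > 0"
          "\<And>y. norm y < \<delta> \<Longrightarrow> J z + \<nu> \<bullet> y - \<epsilon> * norm y \<le> J (z + y)"
        using \<nu> \<open>\<epsilon> > 0\<close> unfolding generalized_differential_def by auto
      define t where "t = min 1 (\<delta> / (2 * (norm y + 1)))"
      have t: "0 < t" "t \<le> 1"
        using \<open>\<delta> > 0\<close> by (auto simp: t_def add_nonneg_pos)
      have "t * norm y \<le> \<delta> / (2 * (norm y + 1)) * norm y"
        by (intro mult_right_mono) (auto simp: t_def)
      also have "\<dots> < \<delta>"
        using \<open>\<delta> > 0\<close> by (simp add: divide_simps add_nonneg_pos)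
      finally have "norm (t *\<^sub>R y) < \<delta>"
        using t by simp
      from \<delta>(2)[OF this] have "J z + t * (\<nu> \<bullet> y) - t * (\<epsilon> * norm y) \<le> J (z + t *\<^sub>R y)"
        using t by (simp add: mult_ac)
      also have "z + t *\<^sub>R y = (1 - t) *\<^sub>R z + t *\<^sub>R (z + y)"
        by (simp add: algebra_simps)
      also have "J \<dots> \<le> (1 - t) * J z + t * J (z + y)"
        using assms t by (intro convex_onD) auto
      finally have "t * (J z + \<nu> \<bullet> y) \<le> t * (J (z + y) + \<epsilon> * norm y)"
        by (simp add: algebra_simps)
      then show ?thesis
        using t by simp
    qed
    note * = this
    show ?thesis
    proof (rule field_le_epsilon)
      fix c :: real assume "c > 0"
      then have "c / (norm y + 1) > 0" "c / (norm y + 1) * norm y \<le> c"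
        by (simp_all add: divide_simps add_nonneg_pos)
      then show "J z + \<nu> \<bullet> y \<le> J (z + y) + c"
        using *[of "c / (norm y + 1)"] by linarith
    qed
  qed
  then show "\<nu> \<in> {\<nu>. \<forall>y. J (z + y) \<ge> J z + \<nu> \<bullet> y}"
    by simp
qed

definition subproblem_solution :: "('v::real_inner \<Rightarrow> 'v \<Rightarrow> real) \<Rightarrow> 'v \<Rightarrow> real \<Rightarrow> 'v \<Rightarrow> bool" where
  "subproblem_solution L z r d \<longleftrightarrow> norm d \<le> r \<and> (\<forall>d'. norm d' \<le> r \<longrightarrow> L z d \<le> L z d')"

definition actual_change :: "('v::real_inner \<Rightarrow> real) \<Rightarrow> 'v \<Rightarrow> 'v \<Rightarrow> real" where
  "actual_change J z d = J z - J (z + d)"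

definition predicted_change ::
  "('v::real_inner \<Rightarrow> real) \<Rightarrow> ('v \<Rightarrow> 'v \<Rightarrow> real) \<Rightarrow> 'v \<Rightarrow> 'v \<Rightarrow> real" where
  "predicted_change J L z d = J z - L z d"

definition new_radius ::
  "real \<Rightarrow> real \<Rightarrow> real \<Rightarrow> real \<Rightarrow> real \<Rightarrow> real \<Rightarrow> real \<Rightarrow> real" where
  "new_radius rho1 rho2 rl \<alpha> \<beta> r rho =
     max (if rho < rho1 then r / \<alpha> else if rho < rho2 then r else \<beta> * r) rl"

text \<open>
  One pass through Steps 1--3, from the iterate and radius \<open>(z, r)\<close> to those with which Step 1 is
  entered next, with \<open>J\<close> the function to be minimized and \<open>L z\<close> its approximation at \<open>z\<close>. There is
  no successor if the algorithm stops, because the actual change is \<open>0\<close> or because an accepted step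
  fails the loop condition \<open>actual change > eps_tol\<close>. If the predicted change is \<open>0\<close> but the actual
  change is not, then \<open>\<rho>\<close> is \<open>0\<close> by the convention for division and the step is rejected.
\<close>

definition scvx_pass ::
  "('v::real_inner \<Rightarrow> real) \<Rightarrow> ('v \<Rightarrow> 'v \<Rightarrow> real) \<Rightarrow> real \<Rightarrow> real \<Rightarrow> real \<Rightarrow> real \<Rightarrow> real \<Rightarrow>
   real \<Rightarrow> real \<Rightarrow> 'v \<times> real \<Rightarrow> 'v \<times> real \<Rightarrow> bool" where
  "scvx_pass J L eps_tol rho0 rho1 rho2 rl \<alpha> \<beta> = (\<lambda>(z, r) (z', r').
     \<exists>d. subproblem_solution L z r d \<and> actual_change J z d \<noteq> 0 \<and>
         (let rho = actual_change J z d / predicted_change J L z d in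
          if rho < rho0
          then z' = z \<and> r' = r / \<alpha>
          else actual_change J z d > eps_tol \<and> z' = z + d
               \<and> r' = new_radius rho1 rho2 rl \<alpha> \<beta> r rho))"

text \<open>
  A nonterminating execution, recorded pass by pass. A rejected step repeats the current iterate,
  so \<open>z\<close> runs through the sequence of iterates with each iterate repeated as often as steps from it
  are rejected. This changes none of the limit points, and it covers an execution that keeps
  rejecting steps from one iterate forever.
\<close>

definition scvx_execution ::
  "('v::real_inner \<Rightarrow> real) \<Rightarrow> ('v \<Rightarrow> 'v \<Rightarrow> real) \<Rightarrow> real \<Rightarrow> real \<Rightarrow> real \<Rightarrow> real \<Rightarrow> real \<Rightarrow>
   real \<Rightarrow> real \<Rightarrow> (nat \<Rightarrow> 'v) \<Rightarrow> (nat \<Rightarrow> real) \<Rightarrow> bool" where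
  "scvx_execution J L eps_tol rho0 rho1 rho2 rl \<alpha> \<beta> z r \<longleftrightarrow>
     r 0 > 0 \<and>
     (\<forall>k. scvx_pass J L eps_tol rho0 rho1 rho2 rl \<alpha> \<beta> (z k, r k) (z (Suc k), r (Suc k)))"

definition limit_point :: "(nat \<Rightarrow> 'v::topological_space) \<Rightarrow> 'v \<Rightarrow> bool" where
  "limit_point z l \<longleftrightarrow> (\<exists>\<phi>. strict_mono \<phi> \<and> (z \<circ> \<phi>) \<longlonglongrightarrow> l)"

definition feasible ::
  "nat \<Rightarrow> nat \<Rightarrow> nat \<Rightarrow> (nat \<Rightarrow> 'v \<Rightarrow> real) \<Rightarrow> (nat \<Rightarrow> 'v \<Rightarrow> real) \<Rightarrow> 'v \<Rightarrow> bool" where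
  "feasible e p q g h z \<longleftrightarrow>
     (\<forall>i\<in>{1..e}. g i z = 0) \<and> (\<forall>i\<in>{e+1..p}. g i z \<le> 0) \<and> (\<forall>j\<in>{1..q}. h j z \<le> 0)"

definition active_nonconvex :: "nat \<Rightarrow> nat \<Rightarrow> (nat \<Rightarrow> 'v \<Rightarrow> real) \<Rightarrow> 'v \<Rightarrow> nat set" where
  "active_nonconvex e p g z = {i\<in>{e+1..p}. g i z = 0}"

definition active_convex :: "nat \<Rightarrow> (nat \<Rightarrow> 'v \<Rightarrow> real) \<Rightarrow> 'v \<Rightarrow> nat set" where
  "active_convex q h z = {j\<in>{1..q}. h j z = 0}"

text \<open>
  Linear independence of the gradients as an indexed family: two constraints with equal gradients
  violate it, which independence of the set of gradients would not detect.
\<close>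

definition licq ::
  "nat \<Rightarrow> nat \<Rightarrow> nat \<Rightarrow> (nat \<Rightarrow> 'v \<Rightarrow> real) \<Rightarrow> (nat \<Rightarrow> 'v \<Rightarrow> real) \<Rightarrow> 'v::real_inner \<Rightarrow> bool" where
  "licq e p q g h z \<longleftrightarrow>
     (\<forall>a b. (\<Sum>i\<in>{1..e} \<union> active_nonconvex e p g z. a i *\<^sub>R gradient (g i) z)
            + (\<Sum>j\<in>active_convex q h z. b j *\<^sub>R gradient (h j) z) = 0
        \<longrightarrow> (\<forall>i\<in>{1..e} \<union> active_nonconvex e p g z. a i = (0::real))
            \<and> (\<forall>j\<in>active_convex q h z. b j = (0::real)))"

definition kkt_point ::
  "nat \<Rightarrow> nat \<Rightarrow> nat \<Rightarrow> (nat \<Rightarrow> 'v \<Rightarrow> real) \<Rightarrow> (nat \<Rightarrow> 'v \<Rightarrow> real) \<Rightarrow> 'v::real_inner \<Rightarrow> bool" where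
  "kkt_point e p q g h z \<longleftrightarrow> feasible e p q g h z \<and>
     (\<exists>\<mu> \<sigma>. (\<forall>i\<in>{e+1..p}. \<mu> i \<ge> (0::real)) \<and> (\<forall>j\<in>{1..q}. \<sigma> j \<ge> (0::real)) \<and>
        gradient (g 0) z
        + (\<Sum>i\<in>{1..e}. \<mu> i *\<^sub>R gradient (g i) z)
        + (\<Sum>i\<in>active_nonconvex e p g z. \<mu> i *\<^sub>R gradient (g i) z)
        + (\<Sum>j\<in>active_convex q h z. \<sigma> j *\<^sub>R gradient (h j) z) = 0)"

end

(* The linearized penalty L(z,.) is convex, agrees with J at d = 0 and approximates J(z + d) up to
   o(|d|), uniformly for z near any point. Hence l is stationary iff d = 0 minimizes L(l,.). If a
   limit point l were not stationary, then near l every step from a small trust region would be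
   accepted, since the predicted decrease is at least linear in the radius while the model error is
   o(radius). So the radius stays bounded below near l, every pass near l is eventually followed by
   an accepted step decreasing J by a fixed amount, and J would drop below its limit J(l).
   At a feasible stationary point the directional derivative of J is nonnegative, and the
   multipliers come from separating minus the gradient of the objective from the zonotope spanned by
   the weighted active gradients. *)

theory Submission
  imports Defs
begin

section \<open>Convex first-order models and their calculus\<close>

text \<open>Collects the properties of \<open>linearized_penalty\<close> on which the convergence
  argument rests, in a form that is stable under sums, nonnegative multiples and maxima. The error
  bound is uniform in the base point \<open>z\<close> near \<open>l\<close>, because it is applied
  at iterates that merely approach \<open>l\<close>. Continuity in \<open>z\<close> is asked for one
  step \<open>d\<close> at a time, which is enough to carry a single descent step from
  \<open>l\<close> to nearby points.\<close>

definition convex_model :: "('v::real_inner \<Rightarrow> real) \<Rightarrow> ('v \<Rightarrow> 'v \<Rightarrow> real) \<Rightarrow> bool" where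
  "convex_model J L \<longleftrightarrow>
     (\<forall>z. L z 0 = J z) \<and> (\<forall>z. convex_on UNIV (L z)) \<and> (\<forall>d. continuous_on UNIV (\<lambda>z. L z d)) \<and>
     (\<forall>l. \<forall>\<epsilon>>0. \<exists>\<delta>>0. \<forall>z d. dist z l < \<delta> \<longrightarrow> norm d < \<delta> \<longrightarrow> \<bar>J (z + d) - L z d\<bar> \<le> \<epsilon> * norm d)"

lemma convex_modelI:
  assumes "\<And>z. L z 0 = J z" "\<And>z. convex_on UNIV (L z)" "\<And>d. continuous_on UNIV (\<lambda>z. L z d)"
    and "\<And>l \<epsilon>. \<epsilon> > 0 \<Longrightarrow>
      \<exists>\<delta>>0. \<forall>z d. dist z l < \<delta> \<longrightarrow> norm d < \<delta> \<longrightarrow> \<bar>J (z + d) - L z d\<bar> \<le> \<epsilon> * norm d"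
  shows "convex_model J L"
  using assms unfolding convex_model_def by blast

lemma convex_modelD:
  assumes "convex_model J L"
  shows "L z 0 = J z" "convex_on UNIV (L z)" "continuous_on UNIV (\<lambda>z. L z d)"
  using assms unfolding convex_model_def by blast+

lemma convex_model_error:
  assumes "convex_model J L" "\<epsilon> > 0"
  obtains \<delta> where "\<delta> > 0"
    "\<And>z d. dist z l < \<delta> \<Longrightarrow> norm d < \<delta> \<Longrightarrow> \<bar>J (z + d) - L z d\<bar> \<le> \<epsilon> * norm d"
  using assms unfolding convex_model_def by metis

lemma convex_model_continuous:
  assumes "convex_model J L"
  shows "continuous_on UNIV J"
  using convex_modelD(3)[OF assms, of 0] by (simp add: convex_modelD(1)[OF assms])

text \<open>Convexity on the segment from \<open>0\<close>, where the model equals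
  \<open>J z\<close>, to \<open>d\<close>: the fraction \<open>t\<close> of a step keeps at least
  the fraction \<open>t\<close> of its decrease. This is why the predicted decrease is at least
  linear in a small radius.\<close>

lemma convex_model_decrease_scaled:
  assumes "convex_model J L" "0 \<le> t" "t \<le> 1"
  shows "L z (t *\<^sub>R d) \<le> J z - t * (J z - L z d)"
  using convex_onD[OF convex_modelD(2)[OF assms(1)], of t 0 d z] assms(2,3)
  by (simp add: convex_modelD(1)[OF assms(1)] algebra_simps)

lemma convex_model_0: "convex_model (\<lambda>z. 0) (\<lambda>z d. 0)"
  by (rule convex_modelI) (auto simp: convex_on_def intro!: exI[of _ 1])

lemma convex_model_add:
  assumes 1: "convex_model J1 L1" and 2: "convex_model J2 L2"
  shows "convex_model (\<lambda>z. J1 z + J2 z) (\<lambda>z d. L1 z d + L2 z d)"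
proof (rule convex_modelI)
  fix l :: 'a and \<epsilon> :: real assume "\<epsilon> > 0"
  then have "\<epsilon> / 2 > 0" by simp
  from convex_model_error[OF 1 this] obtain \<delta>1 where \<delta>1: "\<delta>1 > 0"
    "\<And>z d. dist z l < \<delta>1 \<Longrightarrow> norm d < \<delta>1 \<Longrightarrow> \<bar>J1 (z + d) - L1 z d\<bar> \<le> \<epsilon> / 2 * norm d" by metis
  from convex_model_error[OF 2 \<open>\<epsilon> / 2 > 0\<close>] obtain \<delta>2 where \<delta>2: "\<delta>2 > 0"
    "\<And>z d. dist z l < \<delta>2 \<Longrightarrow> norm d < \<delta>2 \<Longrightarrow> \<bar>J2 (z + d) - L2 z d\<bar> \<le> \<epsilon> / 2 * norm d" by metis
  have "\<bar>J1 (z + d) + J2 (z + d) - (L1 z d + L2 z d)\<bar> \<le> \<epsilon> * norm d"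
    if "dist z l < min \<delta>1 \<delta>2" "norm d < min \<delta>1 \<delta>2" for z d
    using add_mono[OF \<delta>1(2)[of z d] \<delta>2(2)[of z d]] that by auto
  with \<delta>1(1) \<delta>2(1) show "\<exists>\<delta>>0. \<forall>z d. dist z l < \<delta> \<longrightarrow> norm d < \<delta> \<longrightarrow>
      \<bar>J1 (z + d) + J2 (z + d) - (L1 z d + L2 z d)\<bar> \<le> \<epsilon> * norm d"
    by (intro exI[of _ "min \<delta>1 \<delta>2"]) auto
qed (use convex_modelD[OF 1] convex_modelD[OF 2] in \<open>auto intro!: convex_on_add continuous_on_add\<close>)

lemma convex_model_sum:
  assumes "finite A" "\<And>i. i \<in> A \<Longrightarrow> convex_model (J i) (L i)"
  shows "convex_model (\<lambda>z. \<Sum>i\<in>A. J i z) (\<lambda>z d. \<Sum>i\<in>A. L i z d)"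
  using assms by (induction A rule: finite_induct) (simp_all add: convex_model_0 convex_model_add)

lemma convex_model_cmult:
  assumes 1: "convex_model J L" and "c \<ge> 0"
  shows "convex_model (\<lambda>z. c * J z) (\<lambda>z d. c * L z d)"
proof (rule convex_modelI)
  fix l :: 'a and \<epsilon> :: real assume "\<epsilon> > 0"
  \<comment> \<open>The denominator \<open>c + 1\<close> instead of \<open>c\<close> covers
    \<open>c = 0\<close> without a case distinction.\<close>
  then have "\<epsilon> / (c + 1) > 0" using \<open>c \<ge> 0\<close> by simp
  from convex_model_error[OF 1 this] obtain \<delta> where \<delta>: "\<delta> > 0"
    "\<And>z d. dist z l < \<delta> \<Longrightarrow> norm d < \<delta> \<Longrightarrow> \<bar>J (z + d) - L z d\<bar> \<le> \<epsilon> / (c + 1) * norm d" by metis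
  have "\<bar>c * J (z + d) - c * L z d\<bar> \<le> \<epsilon> * norm d"
    if "dist z l < \<delta>" "norm d < \<delta>" for z d
  proof -
    have "\<bar>c * J (z + d) - c * L z d\<bar> = c * \<bar>J (z + d) - L z d\<bar>"
      using \<open>c \<ge> 0\<close> by (simp add: abs_mult flip: right_diff_distrib)
    also have "\<dots> \<le> (c + 1) * (\<epsilon> / (c + 1) * norm d)"
      using \<delta>(2)[OF that] \<open>c \<ge> 0\<close> by (intro mult_mono) auto
    finally show ?thesis using \<open>c \<ge> 0\<close> by simp
  qed
  with \<delta>(1) show "\<exists>\<delta>>0. \<forall>z d. dist z l < \<delta> \<longrightarrow> norm d < \<delta> \<longrightarrow>
      \<bar>c * J (z + d) - c * L z d\<bar> \<le> \<epsilon> * norm d" by blast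
qed (use convex_modelD[OF 1] \<open>c \<ge> 0\<close> in \<open>auto intro!: convex_on_cmul continuous_on_mult_left\<close>)

text \<open>The maximum of two numbers changes by no more than the larger of the two changes, so the
  error bound passes to the maximum with the same \<epsilon>.\<close>

lemma convex_model_max:
  assumes 1: "convex_model J1 L1" and 2: "convex_model J2 L2"
  shows "convex_model (\<lambda>z. max (J1 z) (J2 z)) (\<lambda>z d. max (L1 z d) (L2 z d))"
proof (rule convex_modelI)
  fix z
  have "max (L1 z ((1 - t) *\<^sub>R x + t *\<^sub>R y)) (L2 z ((1 - t) *\<^sub>R x + t *\<^sub>R y))
      \<le> (1 - t) * max (L1 z x) (L2 z x) + t * max (L1 z y) (L2 z y)" if "0 < t" "t < 1" for t x y
  proof (rule max.boundedI)
    have mono: "(1 - t) * a + t * b \<le> (1 - t) * a' + t * b'" if "a \<le> a'" "b \<le> b'" for a a' b b' :: real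
      using that \<open>0 < t\<close> \<open>t < 1\<close> by (intro add_mono mult_left_mono) auto
    show "L1 z ((1 - t) *\<^sub>R x + t *\<^sub>R y) \<le> (1 - t) * max (L1 z x) (L2 z x) + t * max (L1 z y) (L2 z y)"
      using that by (intro order_trans[OF convex_onD[OF convex_modelD(2)[OF 1]] mono]) auto
    show "L2 z ((1 - t) *\<^sub>R x + t *\<^sub>R y) \<le> (1 - t) * max (L1 z x) (L2 z x) + t * max (L1 z y) (L2 z y)"
      using that by (intro order_trans[OF convex_onD[OF convex_modelD(2)[OF 2]] mono]) auto
  qed
  then show "convex_on UNIV (\<lambda>d. max (L1 z d) (L2 z d))"
    by (intro convex_onI) auto
next
  fix l :: 'a and \<epsilon> :: real assume "\<epsilon> > 0"
  from convex_model_error[OF 1 this] obtain \<delta>1 where \<delta>1: "\<delta>1 > 0"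
    "\<And>z d. dist z l < \<delta>1 \<Longrightarrow> norm d < \<delta>1 \<Longrightarrow> \<bar>J1 (z + d) - L1 z d\<bar> \<le> \<epsilon> * norm d" by metis
  from convex_model_error[OF 2 \<open>\<epsilon> > 0\<close>] obtain \<delta>2 where \<delta>2: "\<delta>2 > 0"
    "\<And>z d. dist z l < \<delta>2 \<Longrightarrow> norm d < \<delta>2 \<Longrightarrow> \<bar>J2 (z + d) - L2 z d\<bar> \<le> \<epsilon> * norm d" by metis
  have "\<bar>max (J1 (z + d)) (J2 (z + d)) - max (L1 z d) (L2 z d)\<bar> \<le> \<epsilon> * norm d"
    if "dist z l < min \<delta>1 \<delta>2" "norm d < min \<delta>1 \<delta>2" for z d
    using \<delta>1(2)[of z d] \<delta>2(2)[of z d] that by (simp add: abs_le_iff max_def)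
  with \<delta>1(1) \<delta>2(1) show "\<exists>\<delta>>0. \<forall>z d. dist z l < \<delta> \<longrightarrow> norm d < \<delta> \<longrightarrow>
      \<bar>max (J1 (z + d)) (J2 (z + d)) - max (L1 z d) (L2 z d)\<bar> \<le> \<epsilon> * norm d"
    by (intro exI[of _ "min \<delta>1 \<delta>2"]) auto
qed (use convex_modelD[OF 1] convex_modelD[OF 2] in \<open>auto intro!: continuous_on_max\<close>)

section \<open>Linearizations and the linearized penalty as models\<close>

text \<open>By the mean value theorem on the segment from \<open>z\<close> to \<open>z + d\<close>,
  the error is the inner product of \<open>d\<close> with a difference of two gradients. Both
  gradients are taken near \<open>l\<close>, so continuity of the gradient at \<open>l\<close>
  bounds it uniformly in \<open>z\<close>.\<close>

lemma linearization_error: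
  fixes f :: "'v::real_inner \<Rightarrow> real"
  assumes "continuously_differentiable f" "\<epsilon> > 0"
  shows "\<exists>\<delta>>0. \<forall>z d. dist z l < \<delta> \<longrightarrow> norm d < \<delta> \<longrightarrow>
    \<bar>f (z + d) - linearization f z d\<bar> \<le> \<epsilon> * norm d"
proof -
  have "isCont (gradient f) l"
    using assms(1) by (simp add: continuously_differentiable_def continuous_on_eq_continuous_at)
  then obtain \<eta> where \<eta>: "\<eta> > 0"
    "\<And>w. dist w l < \<eta> \<Longrightarrow> dist (gradient f w) (gradient f l) < \<epsilon> / 2"
    using \<open>\<epsilon> > 0\<close> unfolding continuous_at_eps_delta by (metis half_gt_zero)
  \<comment> \<open>With half of \<eta> for \<open>z\<close> and half for \<open>d\<close>, the
    intermediate point of the mean value theorem stays within \<eta> of \<open>l\<close>. Both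
    gradients are then within half of \<epsilon> of the one at \<open>l\<close>.\<close>
  have "\<bar>f (z + d) - linearization f z d\<bar> \<le> \<epsilon> * norm d"
    if z: "dist z l < \<eta> / 2" and d: "norm d < \<eta> / 2" for z d
  proof -
    have "((\<lambda>t. f (z + t *\<^sub>R d)) has_derivative (\<lambda>s. s * (gradient f (z + t *\<^sub>R d) \<bullet> d)))
        (at t within {0..1})" for t
    proof -
      have 1: "(f has_derivative (\<lambda>h. h \<bullet> gradient f (z + t *\<^sub>R d))) (at (z + t *\<^sub>R d))"
        using assms(1) by (simp add: continuously_differentiable_def gderiv_def)
      have "((\<lambda>t. z + t *\<^sub>R d) has_derivative (\<lambda>s. s *\<^sub>R d)) (at t within {0..1})"
        by (auto intro!: derivative_eq_intros)
      from has_derivative_compose[OF this 1] show ?thesis by (simp add: inner_commute)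
    qed
    then obtain t where t: "t \<in> {0<..<1}"
      "f (z + 1 *\<^sub>R d) - f (z + 0 *\<^sub>R d) = (1 - 0) * (gradient f (z + t *\<^sub>R d) \<bullet> d)"
      using mvt_simple[of 0 1 "\<lambda>t. f (z + t *\<^sub>R d)" "\<lambda>t s. s * (gradient f (z + t *\<^sub>R d) \<bullet> d)"]
      by auto
    have "norm (t *\<^sub>R d) \<le> norm d" using t(1) by (simp add: mult_left_le_one_le)
    then have "dist (z + t *\<^sub>R d) l < \<eta>"
      using z d norm_triangle_ineq[of "z - l" "t *\<^sub>R d"] by (simp add: dist_norm algebra_simps)
    moreover have "dist z l < \<eta>" using z \<eta>(1) by linarith
    ultimately have "dist (gradient f (z + t *\<^sub>R d)) (gradient f z) < \<epsilon>"
      by (intro dist_triangle_half_l[OF \<eta>(2) \<eta>(2)])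
    then have "norm (gradient f (z + t *\<^sub>R d) - gradient f z) * norm d \<le> \<epsilon> * norm d"
      by (intro mult_right_mono) (auto simp: dist_norm)
    then have "\<bar>(gradient f (z + t *\<^sub>R d) - gradient f z) \<bullet> d\<bar> \<le> \<epsilon> * norm d"
      using Cauchy_Schwarz_ineq2 order_trans by blast
    then show ?thesis using t(2) by (simp add: linearization_def inner_diff_left algebra_simps)
  qed
  then show ?thesis using \<eta>(1) by (intro exI[of _ "\<eta> / 2"]) auto
qed

lemma convex_model_linearization:
  assumes "continuously_differentiable f"
  shows "convex_model f (linearization f)"
proof (rule convex_modelI)
  show "convex_on UNIV (linearization f z)" for z
    by (rule convex_onI) (auto simp: linearization_def inner_add_right algebra_simps)
  have "continuous_on UNIV f"
    using assms unfolding continuously_differentiable_def gderiv_def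
    by (meson continuous_at_imp_continuous_on has_derivative_continuous)
  then show "continuous_on UNIV (\<lambda>z. linearization f z d)" for d
    using assms unfolding linearization_def continuously_differentiable_def
    by (auto intro!: continuous_intros)
qed (use linearization_error[OF assms] in \<open>simp_all add: linearization_def\<close>)

text \<open>Convexity does not survive a change of sign in general, but it does for an affine model.
  This supplies the second branch of the absolute values in the penalty.\<close>

lemma convex_model_linearization_uminus:
  assumes "continuously_differentiable f"
  shows "convex_model (\<lambda>z. - f z) (\<lambda>z d. - linearization f z d)"
proof (rule convex_modelI)
  show "convex_on UNIV (\<lambda>d. - linearization f z d)" for z
    by (rule convex_onI) (auto simp: linearization_def inner_add_right algebra_simps)
  show "continuous_on UNIV (\<lambda>z. - linearization f z d)" for d
    using convex_modelD(3)[OF convex_model_linearization[OF assms]] by (rule continuous_on_minus)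
next
  show "\<exists>\<delta>>0. \<forall>z d. dist z l < \<delta> \<longrightarrow> norm d < \<delta> \<longrightarrow>
      \<bar>- f (z + d) - - linearization f z d\<bar> \<le> \<epsilon> * norm d" if "\<epsilon> > 0" for l and \<epsilon> :: real
    using linearization_error[OF assms that, of l] by (simp add: abs_minus_commute)
qed (simp add: linearization_def)

lemma convex_model_linearized_penalty:
  fixes g h :: "nat \<Rightarrow> 'v::real_inner \<Rightarrow> real"
  assumes "e \<le> p"
    and "\<And>i. i \<in> {0..p} \<Longrightarrow> continuously_differentiable (g i)"
    and "\<And>j. j \<in> {1..q} \<Longrightarrow> continuously_differentiable (h j)"
    and "\<And>i. i \<in> {1..p} \<Longrightarrow> lam i \<ge> 0"
    and "\<And>j. j \<in> {1..q} \<Longrightarrow> tau j \<ge> 0"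
  shows "convex_model (penalty e p q g h lam tau) (linearized_penalty e p q g h lam tau)"
proof -
  \<comment> \<open>In this form the penalty is built from linearizations and their negatives by
    maxima, nonnegative multiples and sums alone.\<close>
  have abs_max: "\<bar>x\<bar> = max x (- x)" for x :: real by auto
  show ?thesis
    unfolding penalty_def linearized_penalty_def abs_max
    by (intro convex_model_add convex_model_sum convex_model_cmult convex_model_max convex_model_0
        convex_model_linearization convex_model_linearization_uminus; use assms in auto)
qed

section \<open>Stationarity and the decrease predicted by the model\<close>

text \<open>The error allowed in the generalized differential and the model error are both of order
  \<open>o(norm y)\<close>, so \<open>J\<close> and \<open>L l\<close> have the same first-order
  behaviour at \<open>l\<close>. For the convex \<open>L l\<close>, first-order minimality at
  \<open>0\<close> is global minimality.\<close>

lemma stationary_point_iff_convex_model: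
  assumes "convex_model J L"
  shows "stationary_point J l \<longleftrightarrow> (\<forall>d. J l \<le> L l d)"
proof
  assume st: "stationary_point J l"
  show "\<forall>d. J l \<le> L l d"
  proof (rule ccontr)
    assume "\<not> (\<forall>d. J l \<le> L l d)"
    then obtain d where d: "L l d < J l" by (auto simp: not_le)
    \<comment> \<open>Two errors occur at the scaled step, one from the model and one from
      stationarity. This \<epsilon> keeps each below a quarter of the scaled decrease, which leaves
      half of it as a contradiction. Adding \<open>1\<close> makes the denominator positive.\<close>
    define \<epsilon> where "\<epsilon> = (J l - L l d) / 4 / (norm d + 1)"
    have "\<epsilon> > 0" using d by (simp add: \<epsilon>_def add_nonneg_pos)
    obtain \<delta>1 where \<delta>1: "\<delta>1 > 0"
      "\<And>z d. dist z l < \<delta>1 \<Longrightarrow> norm d < \<delta>1 \<Longrightarrow> \<bar>J (z + d) - L z d\<bar> \<le> \<epsilon> * norm d"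
      using convex_model_error[OF assms \<open>\<epsilon> > 0\<close>] by metis
    obtain \<delta>2 where \<delta>2: "\<delta>2 > 0" "\<And>y. norm y < \<delta>2 \<Longrightarrow> J l - \<epsilon> * norm y \<le> J (l + y)"
      using st \<open>\<epsilon> > 0\<close> by (auto simp: stationary_point_def generalized_differential_def)
    define \<delta> where "\<delta> = min \<delta>1 \<delta>2"
    have "\<delta> > 0" using \<delta>1(1) \<delta>2(1) by (simp add: \<delta>_def)
    \<comment> \<open>Small enough to bring the scaled step inside both neighbourhoods, and at most
      \<open>1\<close> so that convexity applies.\<close>
    define t where "t = min 1 (\<delta> / (2 * (norm d + 1)))"
    have t: "0 < t" "t \<le> 1" using \<open>\<delta> > 0\<close> by (auto simp: t_def add_nonneg_pos)
    have "t * norm d \<le> \<delta> / (2 * (norm d + 1)) * norm d"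
      by (intro mult_right_mono) (auto simp: t_def)
    also have "\<dots> < \<delta>"
      using \<open>\<delta> > 0\<close> by (simp add: divide_simps add_nonneg_pos)
    finally have n: "norm (t *\<^sub>R d) < \<delta>1" "norm (t *\<^sub>R d) < \<delta>2" using t by (auto simp: \<delta>_def)
    have "\<bar>J (l + t *\<^sub>R d) - L l (t *\<^sub>R d)\<bar> \<le> \<epsilon> * norm (t *\<^sub>R d)"
      using \<delta>1(1) n(1) by (intro \<delta>1(2)) auto
    then have "t * (J l - L l d) \<le> 2 * (\<epsilon> * norm (t *\<^sub>R d))"
      using \<delta>2(2)[OF n(2)] convex_model_decrease_scaled[OF assms, of t l d] t by linarith
    then have "J l - L l d \<le> 2 * (\<epsilon> * norm d)" using t by (simp add: mult.left_commute)
    also have "\<epsilon> * norm d \<le> \<epsilon> * (norm d + 1)" using \<open>\<epsilon> > 0\<close> by simp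
    also have "\<dots> = (J l - L l d) / 4"
    proof -
      have "norm d + 1 \<noteq> 0" using norm_ge_zero[of d] by linarith
      then show ?thesis unfolding \<epsilon>_def by (rule nonzero_eq_divide_eq[THEN iffD1, OF _ refl])
    qed
    finally show False using d by simp
  qed
next
  assume *: "\<forall>d. J l \<le> L l d"
  show "stationary_point J l"
    unfolding stationary_point_def generalized_differential_def
  proof (intro CollectI allI impI)
    fix \<epsilon> :: real assume "\<epsilon> > 0"
    obtain \<delta> where \<delta>: "\<delta> > 0"
      "\<And>z d. dist z l < \<delta> \<Longrightarrow> norm d < \<delta> \<Longrightarrow> \<bar>J (z + d) - L z d\<bar> \<le> \<epsilon> * norm d"
      using convex_model_error[OF assms \<open>\<epsilon> > 0\<close>] by metis
    have "J l + 0 \<bullet> y - \<epsilon> * norm y \<le> J (l + y)" if "norm y < \<delta>" for y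
      using \<delta>(2)[of l y] that \<delta>(1) *[rule_format, of y] by auto
    then show "\<exists>\<delta>>0. \<forall>y. norm y < \<delta> \<longrightarrow> J l + 0 \<bullet> y - \<epsilon> * norm y \<le> J (l + y)"
      using \<delta>(1) by blast
  qed
qed

text \<open>A step \<open>d0\<close> that decreases the model at \<open>l\<close> still decreases it
  by at least \<kappa> at nearby \<open>z\<close>, by continuity. Shortened to fit into the trust
  region, it competes with the solution of the subproblem, which must do at least as well.\<close>

lemma predicted_change_lower_bound:
  assumes "convex_model J L" "\<not> stationary_point J l"
  obtains c R \<delta> where "c > 0" "R > 0" "\<delta> > 0"
    "\<And>z r d. dist z l < \<delta> \<Longrightarrow> r > 0 \<Longrightarrow> subproblem_solution L z r d \<Longrightarrow>
       c * min r R \<le> predicted_change J L z d"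
proof -
  obtain d0 where d0: "L l d0 < J l"
    using assms stationary_point_iff_convex_model[OF assms(1)] by (auto simp: not_le)
  then have "d0 \<noteq> 0" using convex_modelD(1)[OF assms(1)] by force
  define \<kappa> where "\<kappa> = (J l - L l d0) / 2"
  have "\<kappa> > 0" using d0 by (simp add: \<kappa>_def)
  have "isCont (\<lambda>z. J z - L z d0) l"
    using convex_model_continuous[OF assms(1)] convex_modelD(3)[OF assms(1), of d0]
    by (auto simp: continuous_on_eq_continuous_at intro!: continuous_diff)
  then obtain \<delta> where \<delta>: "\<delta> > 0"
    "\<And>z. dist z l < \<delta> \<Longrightarrow> dist (J z - L z d0) (J l - L l d0) < \<kappa>"
    using \<open>\<kappa> > 0\<close> unfolding continuous_at_eps_delta by metis
  have gap: "J z - L z d0 \<ge> \<kappa>" if "dist z l < \<delta>" for z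
    using \<delta>(2)[OF that] unfolding dist_real_def \<kappa>_def abs_less_iff by argo
  show ?thesis
  proof (rule that[of "\<kappa> / norm d0" "norm d0" \<delta>])
    fix z r d assume z: "dist z l < \<delta>" and r: "r > 0" and d: "subproblem_solution L z r d"
    \<comment> \<open>The largest fraction of \<open>d0\<close>, up to all of it, that the trust
      region admits.\<close>
    define t where "t = min r (norm d0) / norm d0"
    have t: "0 \<le> t" "t \<le> 1" using r \<open>d0 \<noteq> 0\<close> by (auto simp: t_def)
    have "norm (t *\<^sub>R d0) \<le> r" using r \<open>d0 \<noteq> 0\<close> by (simp add: t_def)
    then have "L z d \<le> L z (t *\<^sub>R d0)" using d by (simp add: subproblem_solution_def)
    also have "\<dots> \<le> J z - t * (J z - L z d0)"
      by (rule convex_model_decrease_scaled[OF assms(1) t])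
    also have "\<dots> \<le> J z - t * \<kappa>" using mult_left_mono[OF gap[OF z] t(1)] by simp
    finally show "\<kappa> / norm d0 * min r (norm d0) \<le> predicted_change J L z d"
      by (simp add: predicted_change_def t_def mult.commute)
  qed (use \<open>\<kappa> > 0\<close> \<open>d0 \<noteq> 0\<close> \<delta> in auto)
qed

text \<open>Actual and predicted change differ by \<open>o(r)\<close>, while the predicted change is
  at least \<open>c * r\<close> for small \<open>r\<close>. Their ratio therefore exceeds any bound
  below \<open>1\<close> once the radius is small, uniformly near \<open>l\<close>. The lower bound
  on the predicted change is repeated so that both facts share their constants.\<close>

lemma step_accepted_near_nonstationary:
  assumes "convex_model J L" "\<not> stationary_point J l" "rho0 < 1"
  obtains c R \<delta> where "c > 0" "R > 0" "\<delta> > 0"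
    "\<And>z r d. dist z l < \<delta> \<Longrightarrow> r > 0 \<Longrightarrow> subproblem_solution L z r d \<Longrightarrow>
       c * min r R \<le> predicted_change J L z d"
    "\<And>z r d. dist z l < \<delta> \<Longrightarrow> 0 < r \<Longrightarrow> r \<le> R \<Longrightarrow> subproblem_solution L z r d \<Longrightarrow>
       rho0 \<le> actual_change J z d / predicted_change J L z d"
proof -
  obtain c R \<delta> where c: "c > 0" "R > 0" "\<delta> > 0"
    "\<And>z r d. dist z l < \<delta> \<Longrightarrow> r > 0 \<Longrightarrow> subproblem_solution L z r d \<Longrightarrow>
       c * min r R \<le> predicted_change J L z d"
    using predicted_change_lower_bound[OF assms(1,2)] by metis
  \<comment> \<open>With this error factor the model error is at most the fraction
    \<open>1 - rho0\<close> of the predicted change, so the fraction \<open>rho0\<close> is left for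
    the actual change.\<close>
  have "(1 - rho0) * c > 0" using assms(3) c(1) by simp
  from convex_model_error[OF assms(1) this] obtain \<eta> where \<eta>: "\<eta> > 0"
    "\<And>z d. dist z l < \<eta> \<Longrightarrow> norm d < \<eta> \<Longrightarrow>
       \<bar>J (z + d) - L z d\<bar> \<le> (1 - rho0) * c * norm d" by metis
  \<comment> \<open>Halving \<eta> turns \<open>norm d \<le> r\<close> into the strict bound that
    the error estimate asks for.\<close>
  define R' where "R' = min R (\<eta> / 2)"
  have R': "R' > 0" "R' \<le> R" "R' < \<eta>" using c(2) \<eta>(1) by (auto simp: R'_def)
  show ?thesis
  proof (rule that[of c R' "min \<delta> \<eta>"])
    fix z r d
    assume z: "dist z l < min \<delta> \<eta>" and r: "r > 0" and d: "subproblem_solution L z r d"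
    have "c * min r R' \<le> c * min r R" using c(1) R' by (intro mult_left_mono) auto
    also have "\<dots> \<le> predicted_change J L z d" using c(4)[OF _ r d] z by simp
    finally show "c * min r R' \<le> predicted_change J L z d" .
    assume "r \<le> R'"
    then have pc: "c * r \<le> predicted_change J L z d" using c(4)[OF _ r d] z R' by simp
    have pos: "predicted_change J L z d > 0" using pc c(1) r by (smt (verit) mult_pos_pos)
    have "norm d \<le> r" using d by (simp add: subproblem_solution_def)
    then have "norm d < \<eta>" using \<open>r \<le> R'\<close> R' by linarith
    then have "\<bar>J (z + d) - L z d\<bar> \<le> (1 - rho0) * c * norm d" using \<eta>(2) z by simp
    also have "\<dots> \<le> (1 - rho0) * c * r"
      using \<open>norm d \<le> r\<close> assms(3) c(1) by (intro mult_left_mono) auto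
    also have "\<dots> \<le> (1 - rho0) * predicted_change J L z d"
      using mult_left_mono[OF pc, of "1 - rho0"] assms(3) by (simp add: mult.assoc)
    finally have "rho0 * predicted_change J L z d \<le> actual_change J z d"
      by (simp add: actual_change_def predicted_change_def algebra_simps abs_le_iff)
    then show "rho0 \<le> actual_change J z d / predicted_change J L z d"
      using pos by (simp add: pos_le_divide_eq)
  qed (use c R' \<eta>(1) in auto)
qed

section \<open>Limit points of the algorithm are stationary\<close>

text \<open>Reduces a pass to the facts used for convergence; for an accepted step,
  \<open>new_radius\<close> enters through its floor \<open>rl\<close>.\<close>

lemma scvx_pass_cases:
  assumes "scvx_pass J L eps_tol rho0 rho1 rho2 rl \<alpha> \<beta> (z, r) (z', r')"
  obtains (rejected) d where "subproblem_solution L z r d"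
      "actual_change J z d / predicted_change J L z d < rho0" "z' = z" "r' = r / \<alpha>"
    | (accepted) d where "subproblem_solution L z r d"
      "rho0 \<le> actual_change J z d / predicted_change J L z d" "actual_change J z d > eps_tol"
      "z' = z + d" "rl \<le> r'"
proof -
  obtain d where d: "subproblem_solution L z r d" and
    step: "if actual_change J z d / predicted_change J L z d < rho0 then z' = z \<and> r' = r / \<alpha>
      else actual_change J z d > eps_tol \<and> z' = z + d \<and>
        r' = new_radius rho1 rho2 rl \<alpha> \<beta> r (actual_change J z d / predicted_change J L z d)"
    using assms unfolding scvx_pass_def Let_def by auto
  show ?thesis
  proof (cases "actual_change J z d / predicted_change J L z d < rho0")
    case True
    then show ?thesis using rejected[OF d] step by simp
  next
    case False
    then show ?thesis using accepted[OF d] step by (simp add: new_radius_def)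
  qed
qed

text \<open>Consider a late iterate near a nonstationary \<open>l\<close>. An accepted step from it
  would push \<open>J\<close> below its limit value, and endless rejection would push the radius
  below a positive bound valid near \<open>l\<close>. Neither is possible.\<close>

theorem scvx_limit_point_stationary:
  assumes model: "convex_model J L"
    and "eps_tol \<ge> 0" "0 < rho0" "rho0 < 1" "rl > 0" "\<alpha> > 1"
    and exec: "scvx_execution J L eps_tol rho0 rho1 rho2 rl \<alpha> \<beta> z r"
    and "limit_point z l"
  shows "stationary_point J l"
proof (rule ccontr)
  assume nst: "\<not> stationary_point J l"
  note pass = exec[unfolded scvx_execution_def, THEN conjunct2, rule_format]
  have r_pos: "r k > 0" for k
  proof (induction k)
    case 0
    then show ?case using exec by (simp add: scvx_execution_def)
  next
    case (Suc k)
    from pass[of k] show ?case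
      by (cases rule: scvx_pass_cases) (use Suc assms in auto)
  qed
  have "J (z (Suc k)) \<le> J (z k)" for k
    using pass[of k]
    by (cases rule: scvx_pass_cases) (use \<open>eps_tol \<ge> 0\<close> in \<open>auto simp: actual_change_def\<close>)
  then have dec: "decseq (\<lambda>k. J (z k))" by (simp add: decseq_Suc_iff)
  obtain \<phi> where \<phi>: "strict_mono \<phi>" "(z \<circ> \<phi>) \<longlonglongrightarrow> l"
    using \<open>limit_point z l\<close> by (auto simp: limit_point_def)
  have "isCont J l"
    using convex_model_continuous[OF model] by (simp add: continuous_on_eq_continuous_at)
  then have J_lim: "(\<lambda>k. J (z (\<phi> k))) \<longlonglongrightarrow> J l"
    using isCont_tendsto_compose[OF _ \<phi>(2)] by (simp add: o_def)
  \<comment> \<open>The values tend to \<open>J l\<close> along the subsequence, and monotonicity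
    extends the lower bound to every index.\<close>
  have J_ge: "J l \<le> J (z k)" for k
  proof (rule LIMSEQ_le_const2[OF J_lim], intro exI allI impI)
    fix n assume "n \<ge> k"
    then show "J (z (\<phi> n)) \<le> J (z k)"
      using decseqD[OF dec] seq_suble[OF \<phi>(1), of n] order_trans by blast
  qed
  obtain c R \<delta> where c: "c > 0" "R > 0" "\<delta> > 0"
    and pc: "\<And>z r d. dist z l < \<delta> \<Longrightarrow> r > 0 \<Longrightarrow> subproblem_solution L z r d \<Longrightarrow>
       c * min r R \<le> predicted_change J L z d"
    and acc: "\<And>z r d. dist z l < \<delta> \<Longrightarrow> 0 < r \<Longrightarrow> r \<le> R \<Longrightarrow> subproblem_solution L z r d \<Longrightarrow>
       rho0 \<le> actual_change J z d / predicted_change J L z d"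
    using step_accepted_near_nonstationary[OF model nst \<open>rho0 < 1\<close>] by metis
  \<comment> \<open>An accepted pass leaves a radius of at least \<open>rl\<close>. A pass rejected
    near \<open>l\<close> had a radius above \<open>R\<close>, so it leaves more than
    \<open>R / \<alpha>\<close>.\<close>
  define m where "m = min rl (R / \<alpha>)"
  have "m > 0" using c assms by (simp add: m_def)
  have radius: "m \<le> r (Suc k)" if near: "dist (z (Suc k)) l < \<delta>" for k
    using pass[of k]
  proof (cases rule: scvx_pass_cases)
    case (rejected d)
    then have "r k > R" using acc[of "z k" "r k" d] near r_pos by (metis not_less)
    then show ?thesis using rejected \<open>\<alpha> > 1\<close> by (auto simp: m_def min_le_iff_disj divide_right_mono)
  qed (auto simp: m_def)
  \<comment> \<open>The decrease of \<open>J\<close> guaranteed by an accepted step near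
    \<open>l\<close> from a radius of at least \<open>m\<close>: the fraction \<open>rho0\<close> of
    the smallest possible predicted change.\<close>
  define \<gamma> where "\<gamma> = rho0 * (c * min m R)"
  have "\<gamma> > 0" using c \<open>m > 0\<close> \<open>0 < rho0\<close> by (simp add: \<gamma>_def)
  have "\<forall>\<^sub>F k in sequentially. dist (z (\<phi> k)) l < \<delta>"
    using tendstoD[OF \<phi>(2) c(3)] by (simp add: o_def)
  moreover have "\<forall>\<^sub>F k in sequentially. J (z (\<phi> k)) < J l + \<gamma>"
    using order_tendstoD(2)[OF J_lim] \<open>\<gamma> > 0\<close> by simp
  \<comment> \<open>The initial radius is known only to be positive and may lie below
    \<open>m\<close>; \<open>radius\<close> applies from index \<open>1\<close> on.\<close>
  moreover have "\<forall>\<^sub>F k in sequentially. 0 < k" by (rule eventually_gt_at_top)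
  ultimately have "\<forall>\<^sub>F k in sequentially.
      dist (z (\<phi> k)) l < \<delta> \<and> J (z (\<phi> k)) < J l + \<gamma> \<and> 0 < k"
    by eventually_elim blast
  then obtain k' where k': "dist (z (\<phi> k')) l < \<delta>" "J (z (\<phi> k')) < J l + \<gamma>" "0 < k'"
    using eventually_happens'[OF sequentially_bot] by blast
  define k where "k = \<phi> k'"
  have k: "dist (z k) l < \<delta>" "J (z k) < J l + \<gamma>" "0 < k"
    using k' seq_suble[OF \<phi>(1), of k'] by (auto simp: k_def)
  \<comment> \<open>Since \<open>J (z k)\<close> is within \<gamma> of its lower bound
    \<open>J l\<close>, no step from \<open>z k\<close> can be accepted, and every later pass only
    shrinks the radius.\<close>
  have stuck: "z (k + n) = z k \<and> r (k + n) = r k / \<alpha> ^ n" for n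
  proof (induction n)
    case (Suc n)
    define K where "K = k + n"
    have zK: "z K = z k" using Suc by (simp add: K_def)
    have "m \<le> r K" using radius[of "K - 1"] k zK by (simp add: K_def)
    from pass[of K] show ?case
    proof (cases rule: scvx_pass_cases)
      case (rejected d)
      then show ?thesis using Suc by (simp add: K_def mult.commute)
    next
      case (accepted d)
      have "c * min m R \<le> c * min (r K) R" using \<open>m \<le> r K\<close> c by (intro mult_left_mono) auto
      also have "\<dots> \<le> predicted_change J L (z K) d"
        using pc[OF _ r_pos accepted(1)] k zK by simp
      finally have *: "c * min m R \<le> predicted_change J L (z K) d" .
      \<comment> \<open>Positivity of the predicted change is what allows the ratio test to be
        multiplied out.\<close>
      moreover have "c * min m R > 0" using c \<open>m > 0\<close> by simp
      ultimately have "rho0 * predicted_change J L (z K) d \<le> actual_change J (z K) d"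
        using accepted(2) by (subst (asm) pos_le_divide_eq) auto
      then have "\<gamma> \<le> actual_change J (z K) d"
        using mult_left_mono[OF *, of rho0] \<open>0 < rho0\<close> unfolding \<gamma>_def by linarith
      then have "J (z (Suc K)) < J l"
        using k(2) zK accepted(4) by (simp add: actual_change_def)
      then show ?thesis using J_ge[of "Suc K"] by simp
    qed
  qed simp
  have "(\<lambda>n. r k / \<alpha> ^ n) \<longlonglongrightarrow> 0"
    using LIMSEQ_divide_realpow_zero[OF \<open>\<alpha> > 1\<close>] .
  then have "\<forall>\<^sub>F n in sequentially. r k / \<alpha> ^ n < m"
    using \<open>m > 0\<close> by (rule order_tendstoD)
  then obtain n where n: "r k / \<alpha> ^ n < m"
    using eventually_happens'[OF sequentially_bot] by blast
  then show False using radius[of "k + n - 1"] stuck[of n] k by simp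
qed

section \<open>Multipliers at feasible stationary points\<close>

text \<open>
  The sum in the last assumption is the support function of the zonotope spanned by the \<open>w i\<close>.
\<close>

lemma zero_in_translated_zonotope:
  fixes v :: "'v::euclidean_space" and w :: "'i \<Rightarrow> 'v"
  assumes "finite A" "\<And>i. i \<in> A \<Longrightarrow> lo i \<le> hi i"
    and nonneg: "\<And>d. 0 \<le> v \<bullet> d + (\<Sum>i\<in>A. max (lo i * (w i \<bullet> d)) (hi i * (w i \<bullet> d)))"
  obtains c where "\<And>i. i \<in> A \<Longrightarrow> lo i \<le> c i \<and> c i \<le> hi i" "v + (\<Sum>i\<in>A. c i *\<^sub>R w i) = 0"
proof -
  \<comment> \<open>Defined for every index set \<open>B\<close>, so that induction can add one
    segment at a time: the zonotope is a Minkowski sum of compact convex segments.\<close>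
  define K where "K B = {\<Sum>i\<in>B. c i *\<^sub>R w i |c. \<forall>i\<in>B. lo i \<le> c i \<and> c i \<le> hi i}" for B
  have "compact (K A) \<and> convex (K A)"
    using \<open>finite A\<close>
  proof (induction A rule: finite_induct)
    case empty
    then show ?case by (simp add: K_def)
  next
    case (insert a B)
    have "K (insert a B) = (\<Union>x\<in>(\<lambda>c. c *\<^sub>R w a) ` {lo a..hi a}. \<Union>y\<in>K B. {x + y})"
    proof (intro set_eqI iffI)
      fix x assume "x \<in> K (insert a B)"
      then show "x \<in> (\<Union>x\<in>(\<lambda>c. c *\<^sub>R w a) ` {lo a..hi a}. \<Union>y\<in>K B. {x + y})"
        using insert.hyps by (fastforce simp: K_def)
    next
      fix x assume "x \<in> (\<Union>x\<in>(\<lambda>c. c *\<^sub>R w a) ` {lo a..hi a}. \<Union>y\<in>K B. {x + y})"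
      then obtain s c where c: "lo a \<le> s" "s \<le> hi a" "\<forall>i\<in>B. lo i \<le> c i \<and> c i \<le> hi i"
        "x = s *\<^sub>R w a + (\<Sum>i\<in>B. c i *\<^sub>R w i)" by (auto simp: K_def)
      have "(\<Sum>i\<in>B. c i *\<^sub>R w i) = (\<Sum>i\<in>B. (c(a := s)) i *\<^sub>R w i)"
        using insert.hyps by (intro sum.cong) auto
      then show "x \<in> K (insert a B)"
        unfolding K_def using insert.hyps c by (intro CollectI exI[of _ "c(a := s)"]) auto
    qed
    moreover have "compact ((\<lambda>c. c *\<^sub>R w a) ` {lo a..hi a})"
      by (intro compact_continuous_image continuous_intros) auto
    moreover have "convex ((\<lambda>c. c *\<^sub>R w a) ` {lo a..hi a})"
      by (intro convex_linear_image) (auto simp: linear_iff algebra_simps)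
    ultimately show ?case using insert.IH by (simp only: compact_sums' convex_sums)
  qed
  have "- v \<in> K A"
  proof (rule ccontr)
    assume "- v \<notin> K A"
    then obtain a b where ab: "a \<bullet> (- v) < b" "\<And>x. x \<in> K A \<Longrightarrow> b < a \<bullet> x"
      using separating_hyperplane_closed_point[of "K A" "- v"]
        \<open>compact (K A) \<and> convex (K A)\<close> compact_imp_closed by metis
    \<comment> \<open>These coefficients give a point of the zonotope that minimizes the inner
      product with \<open>a\<close>. The minimum is minus the support function at
      \<open>- a\<close>, so the separation contradicts \<open>nonneg\<close> in the direction
      \<open>- a\<close>.\<close>
    define c where "c i = (if w i \<bullet> (- a) \<ge> 0 then hi i else lo i)" for i
    have "(\<Sum>i\<in>A. c i *\<^sub>R w i) \<in> K A"
      unfolding K_def using assms(2) by (auto simp: c_def)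
    from ab(2)[OF this] have "b < (\<Sum>i\<in>A. c i * (w i \<bullet> a))"
      by (simp add: inner_sum_right inner_commute)
    also have "\<dots> = - (\<Sum>i\<in>A. max (lo i * (w i \<bullet> (- a))) (hi i * (w i \<bullet> (- a))))"
      unfolding sum_negf[symmetric]
    proof (rule sum.cong[OF refl])
      fix i assume "i \<in> A"
      then show "c i * (w i \<bullet> a) = - max (lo i * (w i \<bullet> - a)) (hi i * (w i \<bullet> - a))"
        using mult_right_mono[OF assms(2), of i "w i \<bullet> - a"]
          mult_right_mono_neg[OF assms(2), of i "w i \<bullet> - a"]
        by (auto simp: c_def max_def)
    qed
    finally show False using nonneg[of "- a"] ab(1) by (simp add: inner_commute)
  qed
  then obtain c where c: "\<forall>i\<in>A. lo i \<le> c i \<and> c i \<le> hi i" "- v = (\<Sum>i\<in>A. c i *\<^sub>R w i)"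
    by (auto simp: K_def)
  then show ?thesis by (intro that[of c]) (auto simp flip: c(2))
qed

text \<open>Meant for inactive inequalities: along a short step their linearization stays negative,
  so their terms vanish from the linearized penalty.\<close>

lemma eventually_linearization_nonpos:
  assumes "f z < 0"
  shows "\<forall>\<^sub>F t in at_right 0. linearization f z (t *\<^sub>R d) \<le> 0"
proof -
  have "((\<lambda>t. linearization f z (t *\<^sub>R d)) \<longlongrightarrow> f z + gradient f z \<bullet> (0 *\<^sub>R d)) (at_right 0)"
    unfolding linearization_def by (intro tendsto_intros)
  then have "\<forall>\<^sub>F t in at_right 0. linearization f z (t *\<^sub>R d) < 0"
    using assms by (intro order_tendstoD) auto
  then show ?thesis by eventually_elim simp
qed

text \<open>Along a ray the linearized penalty is piecewise affine, hence exactly affine for small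
  \<open>t > 0\<close>. Equality and active constraints have linearizations homogeneous in
  \<open>t\<close>, and inactive ones contribute nothing. The factor of \<open>t\<close> is the
  one-sided directional derivative.\<close>

lemma linearized_penalty_directional:
  fixes g h :: "nat \<Rightarrow> 'v::real_inner \<Rightarrow> real"
  assumes feas: "feasible e p q g h z"
  shows "\<forall>\<^sub>F t in at_right 0. linearized_penalty e p q g h lam tau z (t *\<^sub>R d) = g 0 z + t *
    (gradient (g 0) z \<bullet> d + (\<Sum>i\<in>{1..e}. lam i * \<bar>gradient (g i) z \<bullet> d\<bar>)
     + (\<Sum>i\<in>active_nonconvex e p g z. lam i * max 0 (gradient (g i) z \<bullet> d))
     + (\<Sum>j\<in>active_convex q h z. tau j * max 0 (gradient (h j) z \<bullet> d)))"
proof -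
  have "\<forall>\<^sub>F t in at_right 0. \<forall>i\<in>{e+1..p} - active_nonconvex e p g z. linearization (g i) z (t *\<^sub>R d) \<le> 0"
    using feas by (intro eventually_ball_finite ballI eventually_linearization_nonpos)
      (force simp: feasible_def active_nonconvex_def)+
  moreover have "\<forall>\<^sub>F t in at_right 0. \<forall>j\<in>{1..q} - active_convex q h z. linearization (h j) z (t *\<^sub>R d) \<le> 0"
    using feas by (intro eventually_ball_finite ballI eventually_linearization_nonpos)
      (force simp: feasible_def active_convex_def)+
  moreover have "\<forall>\<^sub>F t::real in at_right 0. t > 0" by (simp add: eventually_at_right_less)
  ultimately show ?thesis
  proof eventually_elim
    case (elim t)
    have lin: "linearization f z (t *\<^sub>R d) = t * (gradient f z \<bullet> d)" if "f z = 0" for f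
      using that by (simp add: linearization_def)
    have max_t: "max 0 (t * x) = t * max 0 x" for x
      using elim(3) by (simp add: max_mult_distrib_left)
    have "(\<Sum>i\<in>{1..e}. lam i * \<bar>linearization (g i) z (t *\<^sub>R d)\<bar>)
        = t * (\<Sum>i\<in>{1..e}. lam i * \<bar>gradient (g i) z \<bullet> d\<bar>)"
      unfolding sum_distrib_left
      using feas elim(3) by (intro sum.cong) (auto simp: feasible_def lin abs_mult)
    moreover have "(\<Sum>i\<in>{e+1..p}. lam i * max 0 (linearization (g i) z (t *\<^sub>R d)))
        = (\<Sum>i\<in>active_nonconvex e p g z. lam i * max 0 (linearization (g i) z (t *\<^sub>R d)))"
      by (intro sum.mono_neutral_right ballI)
        (simp_all add: elim max_absorb1, auto simp: active_nonconvex_def)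
    moreover have "\<dots> = t * (\<Sum>i\<in>active_nonconvex e p g z. lam i * max 0 (gradient (g i) z \<bullet> d))"
      unfolding sum_distrib_left
      by (intro sum.cong) (auto simp: active_nonconvex_def lin max_t)
    moreover have "(\<Sum>j\<in>{1..q}. tau j * max 0 (linearization (h j) z (t *\<^sub>R d)))
        = (\<Sum>j\<in>active_convex q h z. tau j * max 0 (linearization (h j) z (t *\<^sub>R d)))"
      by (intro sum.mono_neutral_right ballI)
        (simp_all add: elim max_absorb1, auto simp: active_convex_def)
    moreover have "\<dots> = t * (\<Sum>j\<in>active_convex q h z. tau j * max 0 (gradient (h j) z \<bullet> d))"
      unfolding sum_distrib_left
      by (intro sum.cong) (auto simp: active_convex_def lin max_t)
    ultimately show ?case
      by (simp add: linearized_penalty_def distrib_left) (simp add: linearization_def)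
  qed
qed

text \<open>Stationarity makes the directional derivative nonnegative in every direction. Apart from
  the objective it is the support function of a zonotope spanned by the gradients of the equality
  and active constraints, and the coefficients of the point found there are the multipliers.\<close>

lemma feasible_stationary_imp_kkt_point:
  fixes g h :: "nat \<Rightarrow> 'v::euclidean_space \<Rightarrow> real"
  assumes "e \<le> p"
    and "\<And>i. i \<in> {0..p} \<Longrightarrow> continuously_differentiable (g i)"
    and "\<And>j. j \<in> {1..q} \<Longrightarrow> continuously_differentiable (h j)"
    and lam: "\<And>i. i \<in> {1..p} \<Longrightarrow> lam i \<ge> 0"
    and tau: "\<And>j. j \<in> {1..q} \<Longrightarrow> tau j \<ge> 0"
    and st: "stationary_point (penalty e p q g h lam tau) z" and feas: "feasible e p q g h z"
  shows "kkt_point e p q g h z"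
proof -
  note model = convex_model_linearized_penalty[where p = p and q = q and g = g and h = h
      and lam = lam and tau = tau, OF assms(1-5)]
  let ?I = "{1..e} \<union> active_nonconvex e p g z" and ?J = "active_convex q h z"
  have fin: "finite (active_nonconvex e p g z)" "finite ?J"
    by (auto simp: active_nonconvex_def active_convex_def)
  have disj: "{1..e} \<inter> active_nonconvex e p g z = {}" by (auto simp: active_nonconvex_def)
  have J_z: "penalty e p q g h lam tau z = g 0 z"
    using feas by (simp add: penalty_def feasible_def max_absorb1)
  have dir: "0 \<le> gradient (g 0) z \<bullet> d + (\<Sum>i\<in>{1..e}. lam i * \<bar>gradient (g i) z \<bullet> d\<bar>)
     + (\<Sum>i\<in>active_nonconvex e p g z. lam i * max 0 (gradient (g i) z \<bullet> d))
     + (\<Sum>j\<in>?J. tau j * max 0 (gradient (h j) z \<bullet> d))" (is "0 \<le> ?\<phi>") for d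
  proof -
    have "\<forall>\<^sub>F t::real in at_right 0. t > 0" by (simp add: eventually_at_right_less)
    with linearized_penalty_directional[OF feas, of lam tau d]
    have "\<forall>\<^sub>F t in at_right 0. t > 0 \<and>
        linearized_penalty e p q g h lam tau z (t *\<^sub>R d) = g 0 z + t * ?\<phi>"
      by eventually_elim blast
    then obtain t where t: "t > 0"
        "linearized_penalty e p q g h lam tau z (t *\<^sub>R d) = g 0 z + t * ?\<phi>"
      using eventually_happens'[OF trivial_limit_at_right_real] by blast
    have "g 0 z \<le> g 0 z + t * ?\<phi>"
      using st stationary_point_iff_convex_model[OF model] t(2) J_z by metis
    then show ?thesis using t(1) by (simp add: zero_le_mult_iff)
  qed
  \<comment> \<open>The sum type indexes the gradients of \<open>g\<close> and \<open>h\<close> as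
    one family. The intervals from \<open>lo\<close> to \<open>hi\<close> are the subdifferentials
    at \<open>0\<close> of the weighted absolute value for equalities and of the weighted positive
    part for active inequalities.\<close>
  define lo :: "nat + nat \<Rightarrow> real" where "lo = case_sum (\<lambda>i. if i \<le> e then - lam i else 0) (\<lambda>j. 0)"
  define hi where "hi = case_sum lam tau"
  define w where "w = case_sum (\<lambda>i. gradient (g i) z) (\<lambda>j. gradient (h j) z)"
  have lo_hi: "lo i \<le> hi i" if "i \<in> ?I <+> ?J" for i
    using that lam tau \<open>e \<le> p\<close>
    by (auto simp: lo_def hi_def active_nonconvex_def active_convex_def)
  have split: "(\<Sum>i\<in>?I <+> ?J. f i) = (\<Sum>i\<in>{1..e}. f (Inl i))
      + (\<Sum>i\<in>active_nonconvex e p g z. f (Inl i)) + (\<Sum>j\<in>?J. f (Inr j))"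
    for f :: "nat + nat \<Rightarrow> 'b::comm_monoid_add"
    using fin disj by (simp add: sum.Plus sum.union_disjoint o_def)
  have "0 \<le> gradient (g 0) z \<bullet> d + (\<Sum>i\<in>?I <+> ?J. max (lo i * (w i \<bullet> d)) (hi i * (w i \<bullet> d)))" for d
  proof -
    have "(\<Sum>i\<in>{1..e}. lam i * \<bar>gradient (g i) z \<bullet> d\<bar>)
        = (\<Sum>i\<in>{1..e}. max (lo (Inl i) * (w (Inl i) \<bullet> d)) (hi (Inl i) * (w (Inl i) \<bullet> d)))"
    proof (rule sum.cong[OF refl])
      fix i assume "i \<in> {1..e}"
      then show "lam i * \<bar>gradient (g i) z \<bullet> d\<bar>
          = max (lo (Inl i) * (w (Inl i) \<bullet> d)) (hi (Inl i) * (w (Inl i) \<bullet> d))"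
        using lam[of i] \<open>e \<le> p\<close>
        by (simp add: lo_def hi_def w_def abs_real_def max_def mult_le_0_iff zero_le_mult_iff)
    qed
    moreover have "(\<Sum>i\<in>active_nonconvex e p g z. lam i * max 0 (gradient (g i) z \<bullet> d))
        = (\<Sum>i\<in>active_nonconvex e p g z.
            max (lo (Inl i) * (w (Inl i) \<bullet> d)) (hi (Inl i) * (w (Inl i) \<bullet> d)))"
      using lam by (intro sum.cong)
        (auto simp: lo_def hi_def w_def active_nonconvex_def max_mult_distrib_left)
    moreover have "(\<Sum>j\<in>?J. tau j * max 0 (gradient (h j) z \<bullet> d))
        = (\<Sum>j\<in>?J. max (lo (Inr j) * (w (Inr j) \<bullet> d)) (hi (Inr j) * (w (Inr j) \<bullet> d)))"
      using tau by (intro sum.cong)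
        (auto simp: lo_def hi_def w_def active_convex_def max_mult_distrib_left)
    ultimately show ?thesis
      using dir[of d] unfolding split by linarith
  qed
  from zero_in_translated_zonotope[OF _ lo_hi this] fin obtain c where
    c: "\<And>i. i \<in> ?I <+> ?J \<Longrightarrow> lo i \<le> c i \<and> c i \<le> hi i"
      "gradient (g 0) z + (\<Sum>i\<in>?I <+> ?J. c i *\<^sub>R w i) = 0"
    by (metis finite_Plus finite_UnI finite_atLeastAtMost)
  \<comment> \<open>Inactive inequalities receive the multiplier \<open>0\<close>, so the sign
    conditions hold on the full index ranges.\<close>
  define \<mu> where "\<mu> i = (if i \<in> ?I then c (Inl i) else 0)" for i
  define \<sigma> where "\<sigma> j = (if j \<in> ?J then c (Inr j) else 0)" for j
  have "\<forall>i\<in>{e+1..p}. \<mu> i \<ge> 0"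
    using c(1)[OF InlI] by (fastforce simp: \<mu>_def lo_def)
  moreover have "\<forall>j\<in>{1..q}. \<sigma> j \<ge> 0"
    using c(1)[OF InrI] by (fastforce simp: \<sigma>_def lo_def)
  moreover have "gradient (g 0) z + (\<Sum>i\<in>{1..e}. \<mu> i *\<^sub>R gradient (g i) z)
        + (\<Sum>i\<in>active_nonconvex e p g z. \<mu> i *\<^sub>R gradient (g i) z)
        + (\<Sum>j\<in>?J. \<sigma> j *\<^sub>R gradient (h j) z) = 0"
    using c(2) unfolding split by (simp add: \<mu>_def \<sigma>_def w_def add.assoc)
  ultimately show ?thesis using feas unfolding kkt_point_def by blast
qed

section \<open>Existence of limit points and the combined result\<close>

theorem theorem3p14:
  fixes e p q :: nat
    and g h :: "nat \<Rightarrow> real ^ 'n \<Rightarrow> real"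
    and lam tau :: "nat \<Rightarrow> real"
    and eps_tol rho0 rho1 rho2 rl \<alpha> \<beta> :: real
    and Z :: "(real ^ 'n) set"
    and z :: "nat \<Rightarrow> real ^ 'n" and r :: "nat \<Rightarrow> real"
  assumes "e \<le> p"
    and "\<And>i. i \<in> {0..p} \<Longrightarrow> continuously_differentiable (g i)"
    and "\<And>j. j \<in> {1..q} \<Longrightarrow> continuously_differentiable (h j)"
    and "\<And>j. j \<in> {1..q} \<Longrightarrow> convex_on UNIV (h j)"
    and "\<And>i. i \<in> {1..p} \<Longrightarrow> lam i \<ge> 0"
    and "\<And>j. j \<in> {1..q} \<Longrightarrow> tau j \<ge> 0"
    and "eps_tol \<ge> 0"
    and "0 < rho0" and "rho0 < rho1" and "rho1 < rho2" and "rho2 < 1"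
    and "rl > 0" and "\<alpha> > 1" and "\<beta> > 1"
    and "convex Z" and "compact Z"
    and "\<And>k. z k \<in> Z"
    and "scvx_execution (penalty e p q g h lam tau) (linearized_penalty e p q g h lam tau)
           eps_tol rho0 rho1 rho2 rl \<alpha> \<beta> z r"
    and "\<And>l. limit_point z l \<Longrightarrow> licq e p q g h l"
  shows "(\<exists>l. limit_point z l) \<and>
         (\<forall>l. limit_point z l \<longrightarrow>
            stationary_point (penalty e p q g h lam tau) l \<and>
            (feasible e p q g h l \<longrightarrow> kkt_point e p q g h l))"
proof -
  \<comment> \<open>In a metric space \<open>compact_def\<close> is sequential compactness, which is
    exactly a limit point for every sequence in \<open>Z\<close>.\<close>
  have "\<exists>l. limit_point z l"
    using \<open>compact Z\<close> assms(17) unfolding compact_def limit_point_def by meson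
  moreover have st: "stationary_point (penalty e p q g h lam tau) l" if "limit_point z l" for l
    using scvx_limit_point_stationary[OF convex_model_linearized_penalty[where p = p and q = q
          and g = g and h = h and lam = lam and tau = tau, OF assms(1-3,5,6)]
        \<open>eps_tol \<ge> 0\<close> \<open>0 < rho0\<close> _ \<open>rl > 0\<close> \<open>\<alpha> > 1\<close> assms(18) that]
      assms(9-11) by simp
  moreover have "kkt_point e p q g h l" if "limit_point z l" "feasible e p q g h l" for l
    using feasible_stationary_imp_kkt_point[where p = p and q = q and g = g and h = h
        and lam = lam and tau = tau, OF assms(1-3,5,6) st[OF that(1)] that(2)] by simp
  ultimately show ?thesis by blast
qed

end
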